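(* Consider an $N$-player game with cost functions $f_i:\mathbb{R}^N\to\mathbb{R}$, $i\in\mathbb{N}=\{1,\dots,N\}$, and player dynamics $\dot x_i=v_i$, $\dot v_i=u_i$ with $x_i,v_i,u_i\in\mathbb{R}$. Suppose that: (1) each $f_i$ is twice continuously differentiable; (2) there is a constant $m>0$ with $(\mathbf{x}-\mathbf{y})^T(\mathcal{P}(\mathbf{x})-\mathcal{P}(\mathbf{y}))\ge m\|\mathbf{x}-\mathbf{y}\|^2$ for all $\mathbf{x},\mathbf{y}\in\mathbb{R}^N$; (3) there is a constant $h>0$ with $\sup_{\mathbf{x}\in\mathbb{R}^N}\|H(\mathbf{x})\|=h$. Let each player $i\in\mathbb{N}$ use the filter-based control $$u_i=-k_1\frac{\partial f_i(\mathbf{x})}{\partial x_i}-k_1y_i,\qquad y_i=-\hat x_i+k_2x_i,\qquad \dot{\hat x}_i=-k_2\hat x_i+k_2^2x_i,$$ where $k_1,k_2$ are positive constants with $$k_1>h+\frac{\epsilon\left(h\sqrt{N}\max_{i\in\mathbb{N}}\{l_i\}+1\right)}{2},\qquad k_2>k_1,$$ and $\epsilon$ is an arbitrary positive constant satisfying $\epsilon>\frac{h\sqrt{N}\max_{i\in\mathbb{N}}\{l_i\}+1}{2m}$. Then Nash equilibrium seeking is achieved, i.e., for every initial condition of the closed-loop system, $$\lim_{t\to\infty}\|\mathbf{x}(t)-\mathbf{x}^*\|=0,\qquad \lim_{t\to\infty}\|\mathbf{v}(t)\|=0,$$ where $\mathbf{x}^*$ is the Nash equilibrium of the game.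
   Context: Notation: $\mathbf{x}=[x_1,\dots,x_N]^T$, $\mathbf{v}=[v_1,\dots,v_N]^T$, $\mathbf{x}_{-i}$ is $\mathbf{x}$ with the entry $x_i$ removed, and $f_i(\mathbf{x})=f_i(x_i,\mathbf{x}_{-i})$. $\|\cdot\|$ is the Euclidean norm for vectors and the induced norm for matrices. $\mathcal{P}(\mathbf{x})=\left[\frac{\partial f_1(\mathbf{x})}{\partial x_1},\dots,\frac{\partial f_N(\mathbf{x})}{\partial x_N}\right]^T$, and $H(\mathbf{x})$ is the $N\times N$ matrix whose $(i,j)$ entry is $\frac{\partial^2 f_i(\mathbf{x})}{\partial x_i\partial x_j}$. A Nash equilibrium is a profile $\mathbf{x}^*=(x_i^*,\mathbf{x}_{-i}^* )$ with $f_i(x_i^*,\mathbf{x}_{-i}^* )\le f_i(x_i,\mathbf{x}_{-i}^* )$ for all $x_i\in\mathbb{R}$, $i\in\mathbb{N}$. Under hypotheses (1)-(2) the Nash equilibrium is unique, and $\mathcal{P}(\mathbf{x}^* )=\mathbf{0}$. By (3), each $\frac{\partial f_i}{\partial x_i}$ is globally Lipschitz on $\mathbb{R}^N$; $l_i$ denotes its Lipschitz constant: $\left|\frac{\partial f_i}{\partial x_i}(\mathbf{x})-\frac{\partial f_i}{\partial x_i}(\mathbf{y})\right|\le l_i\|\mathbf{x}-\mathbf{y}\|$ for all $\mathbf{x},\mathbf{y}\in\mathbb{R}^N$. In the strategy, $\hat x_i\in\mathbb{R}$ is an auxiliary variable and $y_i\in\mathbb{R}$ serves as an estimate of $v_i$.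 *)

theory Defs
  imports "HOL-Analysis.Analysis"
begin

text \<open>The profile \<open>(s, x\<^sub>-\<^sub>i)\<close>: coordinate \<open>i\<close> of \<open>x\<close> is replaced by \<open>s\<close>.\<close>

definition replace_coord :: "real ^ 'n \<Rightarrow> 'n \<Rightarrow> real \<Rightarrow> real ^ 'n" where
  "replace_coord x i s = (\<chi> j. if j = i then s else x $ j)"

definition partial_deriv :: "'n \<Rightarrow> (real ^ 'n \<Rightarrow> real) \<Rightarrow> real ^ 'n \<Rightarrow> real" where
  "partial_deriv i g x = deriv (\<lambda>s. g (replace_coord x i s)) (x $ i)"

definition twice_continuously_differentiable :: "('a::real_normed_vector \<Rightarrow> real) \<Rightarrow> bool" where
  "twice_continuously_differentiable g \<longleftrightarrow>
     (\<exists>(g' :: 'a \<Rightarrow> 'a \<Rightarrow>\<^sub>L real) (g'' :: 'a \<Rightarrow> 'a \<Rightarrow>\<^sub>L 'a \<Rightarrow>\<^sub>L real).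
        (\<forall>x. (g has_derivative blinfun_apply (g' x)) (at x)) \<and>
        (\<forall>x. (g' has_derivative blinfun_apply (g'' x)) (at x)) \<and>
        continuous_on UNIV g'')"

text \<open>In a game, player \<open>i\<close> has cost function \<open>f i\<close> and chooses the coordinate \<open>x $ i\<close>.\<close>

definition nash_equilibrium :: "('n \<Rightarrow> real ^ 'n \<Rightarrow> real) \<Rightarrow> real ^ 'n \<Rightarrow> bool" where
  "nash_equilibrium f x \<longleftrightarrow> (\<forall>i s. f i x \<le> f i (replace_coord x i s))"

definition pseudo_gradient :: "('n \<Rightarrow> real ^ 'n \<Rightarrow> real) \<Rightarrow> real ^ 'n \<Rightarrow> real ^ 'n" where
  "pseudo_gradient f x = (\<chi> i. partial_deriv i (f i) x)"

text \<open>Entry \<open>(i, j)\<close> is \<open>\<partial>\<^sup>2f\<^sub>i / \<partial>x\<^sub>i\<partial>x\<^sub>j\<close>; the cost function depends on the row,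
  so the matrix is not symmetric in general.\<close>

definition game_hessian :: "('n \<Rightarrow> real ^ 'n \<Rightarrow> real) \<Rightarrow> real ^ 'n \<Rightarrow> real ^ 'n ^ 'n" where
  "game_hessian f x = (\<chi> i j. partial_deriv i (partial_deriv j (f i)) x)"

definition filter_estimate :: "real \<Rightarrow> real ^ 'n \<Rightarrow> real ^ 'n \<Rightarrow> real ^ 'n" where
  "filter_estimate k2 x xhat = - xhat + k2 *\<^sub>R x"

definition filter_control ::
    "('n \<Rightarrow> real ^ 'n \<Rightarrow> real) \<Rightarrow> real \<Rightarrow> real \<Rightarrow> real ^ 'n \<Rightarrow> real ^ 'n \<Rightarrow> real ^ 'n" where
  "filter_control f k1 k2 x xhat =
     - k1 *\<^sub>R pseudo_gradient f x - k1 *\<^sub>R filter_estimate k2 x xhat"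

text \<open>Trajectories on \<open>[0, \<infinity>)\<close>; the derivative at time \<open>0\<close> is one-sided. The initial
  values \<open>x 0\<close>, \<open>v 0\<close>, \<open>xhat 0\<close> are unconstrained.\<close>

definition closed_loop_solution ::
    "('n \<Rightarrow> real ^ 'n \<Rightarrow> real) \<Rightarrow> real \<Rightarrow> real \<Rightarrow>
     (real \<Rightarrow> real ^ 'n) \<Rightarrow> (real \<Rightarrow> real ^ 'n) \<Rightarrow> (real \<Rightarrow> real ^ 'n) \<Rightarrow> bool" where
  "closed_loop_solution f k1 k2 x v xhat \<longleftrightarrow>
     (\<forall>t\<ge>0.
        (x has_vector_derivative v t) (at t within {0..}) \<and>
        (v has_vector_derivative filter_control f k1 k2 (x t) (xhat t)) (at t within {0..}) \<and>
        (xhat has_vector_derivative (- k2 *\<^sub>R xhat t + k2\<^sup>2 *\<^sub>R x t)) (at t within {0..}))"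

end

theory Submission
  imports Defs
begin

text \<open>Write \<open>P\<close> for the pseudo-gradient and \<open>y = filter_estimate k2 x xhat\<close>. Differentiating \<open>y\<close>
  eliminates \<open>xhat\<close>: \<open>y' = k2 (v - y)\<close>, so \<open>y\<close> is a low-pass filter of \<open>v\<close>. In the coordinates
  \<open>d = x - xstar\<close>, \<open>w = v + P x\<close>, \<open>e = y - v\<close> the closed loop becomes

    \<open>d' = w - P x\<close>,  \<open>w' = DP(x) v - k1 w - k1 e\<close>,  \<open>e' = k1 w - (k2 - k1) e\<close>.

  Thus \<open>w\<close> measures the deviation from the gradient play \<open>x' = - P x\<close>, and the coupling between \<open>w\<close>
  and \<open>e\<close> is skew-symmetric, so that it drops out of the derivative of
  \<open>V = \<bar>d\<bar>\<^sup>2 + \<bar>w\<bar>\<^sup>2 + \<bar>e\<bar>\<^sup>2\<close>. What remains is damping: strong monotonicity damps \<open>d\<close>, the gain \<open>k1\<close>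
  damps \<open>w\<close>, and \<open>k2 > k1\<close> damps \<open>e\<close>. The only indefinite terms are those from \<open>d \<bullet> w\<close> and from
  \<open>w \<bullet> DP(x) v\<close>; with \<open>\<bar>DP\<bar> \<le> h\<close> and \<open>P\<close> being \<open>L\<close>-Lipschitz with \<open>P xstar = 0\<close> they amount to
  \<open>h \<bar>w\<bar>\<^sup>2\<close> and \<open>(h L + 1) \<bar>d\<bar> \<bar>w\<bar>\<close>. Young's inequality with weight \<open>\<epsilon>\<close> splits the latter, and the
  two bounds on \<open>\<epsilon>\<close> and \<open>k1\<close> say exactly that the damping dominates. Hence \<open>V' \<le> - a V\<close> for some
  \<open>a > 0\<close> and \<open>V\<close> decays exponentially
  (\<open>lyapunov_decay\<close>, \<open>filtered_double_integrator_converges\<close>).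

  Three facts connect the game with this argument. Lipschitz constants \<open>l i\<close> of the components give
  \<open>L = sqrt N * Max (range l)\<close> (\<open>lipschitz_on_vec_lambda\<close>). A Nash equilibrium is a zero of \<open>P\<close>,
  since each player sits at a minimum of a differentiable function
  (\<open>nash_equilibrium_pseudo_gradient_zero\<close>). And \<open>game_hessian\<close> is the Jacobian of \<open>P\<close>
  (\<open>has_derivative_pseudo_gradient\<close>): its entry differentiates \<open>f i\<close> first in direction \<open>j\<close> and then
  in direction \<open>i\<close>, whereas the Jacobian of \<open>P\<close> takes the opposite order, so this is where the
  symmetry of second derivatives (\<open>second_derivative_symmetric\<close>) enters.\<close>

section \<open>Symmetry of second derivatives\<close>

text \<open>The second difference of \<open>f\<close> over the parallelogram spanned by \<open>t u\<close> and \<open>t v\<close> does not depend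
  on the order of the two directions, so it can be compared with both \<open>D u v\<close> and \<open>D v u\<close>. The mean
  value theorem in direction \<open>v\<close> reduces it to a first difference of \<open>f'\<close> in direction \<open>u\<close>, which the
  derivative of \<open>f'\<close> at \<open>x\<close> approximates.\<close>

lemma second_difference_approx:
  fixes f :: "'a::real_normed_vector \<Rightarrow> real" and f' :: "'a \<Rightarrow> 'a \<Rightarrow>\<^sub>L real"
  assumes f': "\<And>z. (f has_derivative blinfun_apply (f' z)) (at z)"
    and f'': "(f' has_derivative D) (at x)"
    and "\<eta> > 0"
  shows "\<exists>\<delta>>0. \<forall>t. 0 < t \<and> t < \<delta> \<longrightarrow>
    \<bar>f (x + t *\<^sub>R u + t *\<^sub>R v) - f (x + t *\<^sub>R u) - f (x + t *\<^sub>R v) + f x - t\<^sup>2 * D u v\<bar> \<le> \<eta> * t\<^sup>2"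
proof -
  interpret D: bounded_linear D
    by (rule has_derivative_bounded_linear[OF f''])
  \<comment> \<open>The relative error allowed for \<open>f'\<close> is \<open>\<eta> / K\<close>: two points at distance at most
    \<open>t (\<bar>u\<bar> + \<bar>v\<bar>)\<close> from \<open>x\<close> contribute, and their errors are evaluated at \<open>v\<close>. The summands \<open>1\<close>
    keep the factors positive when \<open>u\<close> or \<open>v\<close> vanishes.\<close>
  define K where "K = 2 * (norm u + norm v + 1) * (norm v + 1)"
  have K: "K > 0" by (simp add: K_def add_nonneg_pos)
  have "\<eta> / K > 0" using K \<open>\<eta> > 0\<close> by simp
  then obtain d where d: "d > 0"
    and dd: "\<And>z. norm (z - x) < d \<Longrightarrow> norm (f' z - f' x - D (z - x)) \<le> \<eta> / K * norm (z - x)"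
    using f'' unfolding has_derivative_at_alt by blast
  define \<delta> where "\<delta> = d / (norm u + norm v + 1)"
  have pos: "norm u + norm v + 1 > 0" by (simp add: add_nonneg_pos)
  have "\<delta> > 0" using d pos by (simp add: \<delta>_def)
  moreover have "\<bar>f (x + t *\<^sub>R u + t *\<^sub>R v) - f (x + t *\<^sub>R u) - f (x + t *\<^sub>R v) + f x - t\<^sup>2 * D u v\<bar>
      \<le> \<eta> * t\<^sup>2" if t: "0 < t" "t < \<delta>" for t
  proof -
    define \<phi> where "\<phi> s = f (x + t *\<^sub>R u + s *\<^sub>R v) - f (x + s *\<^sub>R v)" for s
    have f'_comp: "(f has_derivative blinfun_apply (f' z)) (at z within S)" for z S
      using f' has_derivative_at_withinI by blast
    define \<phi>' where "\<phi>' s r = f' (x + t *\<^sub>R u + s *\<^sub>R v) (r *\<^sub>R v) - f' (x + s *\<^sub>R v) (r *\<^sub>R v)"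
      for s r
    have deriv: "(\<phi> has_derivative \<phi>' s) (at s)" for s
      unfolding \<phi>_def \<phi>'_def
      by (rule derivative_eq_intros has_derivative_compose[OF _ f'_comp] | simp)+
    have "continuous_on {0..t} \<phi>"
      using has_derivative_at_withinI[OF deriv] by (rule has_derivative_continuous_on)
    then obtain s where s: "0 < s" "s < t" and "\<phi> t - \<phi> 0 = \<phi>' s (t - 0)"
      using mvt[OF \<open>0 < t\<close> _ deriv] by blast
    then have eq: "\<phi> t - \<phi> 0 = t * (f' (x + t *\<^sub>R u + s *\<^sub>R v) - f' (x + s *\<^sub>R v)) v"
      by (simp add: \<phi>'_def blinfun.scaleR_right blinfun.diff_left right_diff_distrib)
    \<comment> \<open>\<open>R\<close> is the remainder of the linearization of \<open>f'\<close> at \<open>x\<close>.\<close>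
    define B where "B = \<eta> / K * (t * (norm u + norm v + 1))"
    define R where "R z = f' z - f' x - D (z - x)" for z
    have R: "norm (R (x + q)) \<le> B"
      if "norm q \<le> t * (norm u + norm v)" for q
    proof -
      have q: "norm q \<le> t * (norm u + norm v + 1)"
        using that t by (simp add: distrib_left)
      also have "\<dots> < d" using t pos by (simp add: \<delta>_def pos_less_divide_eq)
      finally have "norm (R (x + q)) \<le> \<eta> / K * norm q"
        using dd[of "x + q"] by (simp add: R_def)
      also have "\<dots> \<le> B"
        unfolding B_def using q \<open>\<eta> / K > 0\<close> by (intro mult_left_mono) auto
      finally show ?thesis .
    qed
    have sv: "norm (s *\<^sub>R v) \<le> t * norm v" using s by (simp add: mult_right_mono)
    have n1: "norm (s *\<^sub>R v) \<le> t * (norm u + norm v)"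
      using sv t by (simp add: distrib_left add_increasing)
    have n2: "norm (t *\<^sub>R u + s *\<^sub>R v) \<le> t * (norm u + norm v)"
      using sv t norm_triangle_ineq[of "t *\<^sub>R u" "s *\<^sub>R v"] by (simp add: distrib_left)
    have "f' (x + t *\<^sub>R u + s *\<^sub>R v) - f' (x + s *\<^sub>R v)
        = t *\<^sub>R D u + (R (x + (t *\<^sub>R u + s *\<^sub>R v)) - R (x + s *\<^sub>R v))"
      by (simp add: R_def D.add D.scaleR add.assoc)
    then have "\<phi> t - \<phi> 0 - t\<^sup>2 * D u v
        = t * (R (x + (t *\<^sub>R u + s *\<^sub>R v)) - R (x + s *\<^sub>R v)) v"
      unfolding eq
      by (simp only: blinfun.add_left blinfun.scaleR_left) (simp add: power2_eq_square distrib_left)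
    moreover have "\<bar>(R (x + (t *\<^sub>R u + s *\<^sub>R v)) - R (x + s *\<^sub>R v)) v\<bar>
        \<le> norm (R (x + (t *\<^sub>R u + s *\<^sub>R v)) - R (x + s *\<^sub>R v)) * norm v"
      by (metis norm_blinfun real_norm_def)
    moreover have "\<dots> \<le> (2 * B) * (norm v + 1)"
    proof (rule mult_mono)
      show le: "norm (R (x + (t *\<^sub>R u + s *\<^sub>R v)) - R (x + s *\<^sub>R v))
          \<le> 2 * B"
        using R[OF n1] R[OF n2] norm_triangle_ineq4[of "R (x + (t *\<^sub>R u + s *\<^sub>R v))" "R (x + s *\<^sub>R v)"]
        by linarith
      show "0 \<le> 2 * B"
        using norm_ge_zero le by (rule order_trans)
    qed simp_all
    moreover have "\<dots> = \<eta> * t"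
    proof -
      have "2 * (\<eta> / (2 * p * q) * (t * p)) * q = \<eta> * t" if "p > 0" "q > 0" for p q
        using that by (simp add: field_simps)
      from this[OF pos] show ?thesis unfolding B_def K_def by (simp only: add_nonneg_pos norm_ge_zero zero_less_one)
    qed
    ultimately have "\<bar>\<phi> t - \<phi> 0 - t\<^sup>2 * D u v\<bar> \<le> t * (\<eta> * t)"
      using t by (simp add: abs_mult)
    then show ?thesis by (simp add: \<phi>_def power2_eq_square algebra_simps)
  qed
  ultimately show ?thesis by blast
qed

text \<open>Schwarz's theorem with the second derivative assumed at the single point \<open>x\<close>: for small \<open>t\<close>,
  \<open>t\<^sup>2 D u v\<close> and \<open>t\<^sup>2 D v u\<close> are both within \<open>\<eta> t\<^sup>2 / 2\<close> of the same second difference.\<close>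

lemma second_derivative_symmetric:
  fixes f :: "'a::real_normed_vector \<Rightarrow> real" and f' :: "'a \<Rightarrow> 'a \<Rightarrow>\<^sub>L real"
  assumes "\<And>z. (f has_derivative blinfun_apply (f' z)) (at z)"
    and "(f' has_derivative D) (at x)"
  shows "blinfun_apply (D u) v = D v u"
proof -
  have "\<bar>D u v - D v u\<bar> \<le> 0 + \<eta>" if "\<eta> > 0" for \<eta>
  proof -
    have half: "\<eta> / 2 > 0" using that by simp
    obtain d1 where d1: "d1 > 0" and 1: "\<And>t. 0 < t \<Longrightarrow> t < d1 \<Longrightarrow>
      \<bar>f (x + t *\<^sub>R u + t *\<^sub>R v) - f (x + t *\<^sub>R u) - f (x + t *\<^sub>R v) + f x - t\<^sup>2 * D u v\<bar> \<le> \<eta> / 2 * t\<^sup>2"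
      using second_difference_approx[OF assms half, of u v] by blast
    obtain d2 where d2: "d2 > 0" and 2: "\<And>t. 0 < t \<Longrightarrow> t < d2 \<Longrightarrow>
      \<bar>f (x + t *\<^sub>R v + t *\<^sub>R u) - f (x + t *\<^sub>R v) - f (x + t *\<^sub>R u) + f x - t\<^sup>2 * D v u\<bar> \<le> \<eta> / 2 * t\<^sup>2"
      using second_difference_approx[OF assms half, of v u] by blast
    define t where "t = min d1 d2 / 2"
    have t: "0 < t" "t < d1" "t < d2" using d1 d2 by (auto simp: t_def)
    have swap: "x + t *\<^sub>R v + t *\<^sub>R u = x + t *\<^sub>R u + t *\<^sub>R v" by simp
    have "\<bar>t\<^sup>2 * D u v - t\<^sup>2 * D v u\<bar> \<le> \<eta> / 2 * t\<^sup>2 + \<eta> / 2 * t\<^sup>2"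
      using 1[OF t(1,2)] 2[OF t(1,3)] unfolding swap by linarith
    also have "\<bar>t\<^sup>2 * D u v - t\<^sup>2 * D v u\<bar> = t\<^sup>2 * \<bar>D u v - D v u\<bar>"
      by (simp add: abs_mult flip: right_diff_distrib)
    also have "\<eta> / 2 * t\<^sup>2 + \<eta> / 2 * t\<^sup>2 = t\<^sup>2 * \<eta>" by simp
    finally have "t\<^sup>2 * \<bar>D u v - D v u\<bar> \<le> t\<^sup>2 * \<eta>" .
    then show ?thesis using t by simp
  qed
  then show ?thesis using field_le_epsilon[of "\<bar>D u v - D v u\<bar>" 0] by force
qed

section \<open>The pseudo-gradient of a game\<close>

lemma replace_coord_eq: "replace_coord x i s = x + (s - x $ i) *\<^sub>R axis i 1"
  by (simp add: replace_coord_def vec_eq_iff axis_def)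

lemma has_derivative_imp_partial_deriv:
  fixes g :: "real ^ 'n::finite \<Rightarrow> real"
  assumes "(g has_derivative D) (at x)"
  shows "((\<lambda>s. g (replace_coord x i s)) has_real_derivative D (axis i 1)) (at (x $ i))"
    and "partial_deriv i g x = D (axis i 1)"
proof -
  interpret D: bounded_linear D by (rule has_derivative_bounded_linear[OF assms])
  have "((\<lambda>s. replace_coord x i s) has_derivative (\<lambda>s. s *\<^sub>R axis i 1)) (at (x $ i))"
    unfolding replace_coord_eq by (auto intro!: derivative_eq_intros)
  moreover have "(g has_derivative D) (at (replace_coord x i (x $ i)))"
    using assms by (simp add: replace_coord_eq)
  ultimately have "((\<lambda>s. g (replace_coord x i s)) has_derivative (\<lambda>s. D (s *\<^sub>R axis i 1))) (at (x $ i))"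
    by (rule has_derivative_compose)
  then show "((\<lambda>s. g (replace_coord x i s)) has_real_derivative D (axis i 1)) (at (x $ i))"
    by (simp add: has_field_derivative_def D.scaleR mult_commute_abs)
  then show "partial_deriv i g x = D (axis i 1)"
    unfolding partial_deriv_def by (rule DERIV_imp_deriv)
qed

lemma nash_equilibrium_pseudo_gradient_zero:
  fixes f :: "'n::finite \<Rightarrow> real ^ 'n \<Rightarrow> real"
  assumes "\<And>i. f i differentiable (at x)" and "nash_equilibrium f x"
  shows "pseudo_gradient f x = 0"
proof -
  have "partial_deriv i (f i) x = 0" for i
  proof -
    obtain D where D: "(f i has_derivative D) (at x)"
      using assms(1) by (auto simp: differentiable_def)
    have "D (axis i 1) = 0"
    proof (rule DERIV_local_min[OF has_derivative_imp_partial_deriv(1)[OF D, of i]])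
      show "\<forall>s. \<bar>x $ i - s\<bar> < 1 \<longrightarrow> f i (replace_coord x i (x $ i)) \<le> f i (replace_coord x i s)"
        using assms(2) by (simp add: nash_equilibrium_def replace_coord_eq)
    qed simp
    then show ?thesis using has_derivative_imp_partial_deriv(2)[OF D, of i] by simp
  qed
  then show ?thesis by (simp add: pseudo_gradient_def vec_eq_iff)
qed

text \<open>Let \<open>F' i\<close> be the second derivative of \<open>f i\<close>. Component \<open>i\<close> of the pseudo-gradient has
  derivative \<open>F' i x y (axis i 1)\<close> in direction \<open>y\<close>, whereas component \<open>i\<close> of
  \<open>game_hessian f x *v y\<close> is \<open>F' i x (axis i 1) y\<close>. The two agree by symmetry, and this is what lets a
  bound on the norm of \<open>game_hessian\<close> control the rate of change of the pseudo-gradient.\<close>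

lemma has_derivative_pseudo_gradient:
  fixes f :: "'n::finite \<Rightarrow> real ^ 'n \<Rightarrow> real"
  assumes "\<And>i. twice_continuously_differentiable (f i)"
  shows "(pseudo_gradient f has_derivative (*v) (game_hessian f x)) (at x)"
proof -
  have "\<exists>F. \<forall>i. \<exists>F'. (\<forall>z. (f i has_derivative blinfun_apply (F i z)) (at z)) \<and>
      (\<forall>z. (F i has_derivative blinfun_apply (F' z)) (at z))"
    using assms unfolding twice_continuously_differentiable_def by metis
  then obtain F F' where F: "\<And>i z. (f i has_derivative blinfun_apply (F i z)) (at z)"
    and F': "\<And>i z. (F i has_derivative blinfun_apply (F' i z)) (at z)"
    by metis
  have partial: "partial_deriv j (f i) = (\<lambda>z. F i z (axis j 1))" for i j
    using has_derivative_imp_partial_deriv(2)[OF F] by blast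
  have F'_axis: "((\<lambda>z. F i z (axis j 1)) has_derivative (\<lambda>y. F' i z y (axis j 1))) (at z)" for i j z
    using bounded_linear.has_derivative[OF blinfun.bounded_linear_left F'] .
  have "game_hessian f x *v y = (\<chi> i. F' i x y (axis i 1))" for y
  proof (simp add: vec_eq_iff, rule)
    fix i
    have "(game_hessian f x *v y) $ i = (\<Sum>j\<in>UNIV. F' i x (axis i 1) (axis j 1) * y $ j)"
      unfolding game_hessian_def partial matrix_vector_mult_def
      using has_derivative_imp_partial_deriv(2)[OF F'_axis] by simp
    also have "\<dots> = F' i x (axis i 1) (\<Sum>j\<in>UNIV. y $ j *\<^sub>R axis j 1)"
      by (simp add: blinfun.sum_right blinfun.scaleR_right mult.commute)
    also have "(\<Sum>j\<in>UNIV. y $ j *\<^sub>R axis j 1) = y"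
      using basis_expansion[of y] by (simp add: scalar_mult_eq_scaleR)
    also have "F' i x (axis i 1) y = F' i x y (axis i 1)"
      by (rule second_derivative_symmetric[OF F F'])
    finally show "(game_hessian f x *v y) $ i = F' i x y (axis i 1)" .
  qed
  moreover have "(pseudo_gradient f has_derivative (\<lambda>y. \<chi> i. F' i x y (axis i 1))) (at x)"
    unfolding pseudo_gradient_def partial
    by (subst has_derivative_componentwise_within) (auto simp: Basis_vec_def inner_axis F'_axis)
  ultimately show ?thesis by presburger
qed

text \<open>The factor \<open>sqrt (real CARD('n))\<close> is the Euclidean norm of the vector of ones: each component
  of the difference is at most \<open>Max (range l)\<close> times the distance.\<close>

lemma lipschitz_on_vec_lambda:
  fixes g :: "'n::finite \<Rightarrow> 'a::metric_space \<Rightarrow> real"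
  assumes "\<And>i. (l i)-lipschitz_on S (g i)"
  shows "(sqrt (real CARD('n)) * Max (range l))-lipschitz_on S (\<lambda>x. \<chi> i. g i x)"
proof (rule lipschitz_onI)
  have l_le: "l i \<le> Max (range l)" for i by simp
  have l_nonneg: "l i \<ge> 0" for i using assms lipschitz_on_nonneg by blast
  have M: "Max (range l) \<ge> 0" using l_le l_nonneg order_trans by blast
  show "sqrt (real CARD('n)) * Max (range l) \<ge> 0" using M by simp
  fix x y assume "x \<in> S" "y \<in> S"
  then have "dist (g i x) (g i y) \<le> Max (range l) * dist x y" for i
    using lipschitz_onD[OF assms] mult_right_mono[OF l_le zero_le_dist] order_trans by blast
  then have "dist (\<chi> i. g i x) (\<chi> i. g i y)
      \<le> L2_set (\<lambda>_::'n. Max (range l) * dist x y) UNIV"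
    unfolding dist_vec_def by (intro L2_set_mono) auto
  also have "\<dots> = sqrt (real CARD('n)) * Max (range l) * dist x y"
    using M by (simp add: L2_set_def real_sqrt_mult)
  finally show "dist (\<chi> i. g i x) (\<chi> i. g i y) \<le> sqrt (real CARD('n)) * Max (range l) * dist x y" .
qed

section \<open>Convergence by a Lyapunov function\<close>

text \<open>The differential inequality says that \<open>V t * exp (a * t)\<close> is nonincreasing.\<close>

lemma lyapunov_decay:
  fixes V V' :: "real \<Rightarrow> real"
  assumes V': "\<And>t. t \<ge> 0 \<Longrightarrow> (V has_real_derivative V' t) (at t within {0..})"
    and decay: "\<And>t. t \<ge> 0 \<Longrightarrow> V' t \<le> - a * V t"
    and V_nonneg: "\<And>t. V t \<ge> 0" and "a > 0"
  shows "(V \<longlongrightarrow> 0) at_top"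
proof -
  define W where "W t = V t * exp (a * t)" for t
  have W': "(W has_real_derivative (V' t + a * V t) * exp (a * t)) (at t within {0..})" if "t \<ge> 0" for t
    unfolding W_def using V'[OF that]
    by (auto intro!: derivative_eq_intros simp: algebra_simps)
  have bound: "V t \<le> V 0 * exp (- (a * t))" if "t \<ge> 0" for t
  proof -
    have "W t \<le> W 0"
    proof (rule DERIV_nonpos_imp_decreasing_open[OF \<open>t \<ge> 0\<close>])
      fix s assume "0 < s" "s < t"
      then have "at s within {0..} = at s" by (intro at_within_interior) auto
      then show "\<exists>y. (W has_real_derivative y) (at s) \<and> y \<le> 0"
        using W'[of s] decay[of s] \<open>0 < s\<close>
        by (intro exI[of _ "(V' s + a * V s) * exp (a * s)"]) (auto simp: mult_le_0_iff)
    next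
      have "continuous_on {0..} W"
        using W' by (intro DERIV_continuous_on) auto
      then show "continuous_on {0..t} W"
        by (rule continuous_on_subset) auto
    qed
    then show ?thesis by (simp add: W_def exp_minus field_simps)
  qed
  have "((\<lambda>t. exp (- (a * t))) \<longlongrightarrow> 0) at_top"
    using \<open>a > 0\<close>
    by (intro filterlim_compose[OF exp_at_bot] filterlim_compose[OF filterlim_uminus_at_bot_at_top]
        filterlim_tendsto_pos_mult_at_top[OF tendsto_const]) (auto simp: filterlim_ident)
  then have upper: "((\<lambda>t. V 0 * exp (- (a * t))) \<longlongrightarrow> 0) at_top"
    by (rule tendsto_mult_right_zero)
  have "eventually (\<lambda>t. V t \<le> V 0 * exp (- (a * t))) at_top"
    using eventually_ge_at_top[of 0] by eventually_elim (rule bound)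
  then show ?thesis
    by (rule tendsto_sandwich[OF always_eventually _ tendsto_const upper, rotated]) (simp add: V_nonneg)
qed

text \<open>The analytic core, for an arbitrary vector field \<open>P\<close> on an inner product space. The constant
  \<open>c = h * L + 1\<close> is the coefficient of \<open>\<bar>d\<bar> \<bar>w\<bar>\<close> in the bound for the derivative of \<open>V / 2\<close>, and \<open>a\<close> is twice the
  smallest of the three damping coefficients that are left after Young's inequality.\<close>

lemma filtered_double_integrator_converges:
  fixes P :: "'a::real_inner \<Rightarrow> 'a" and x v y :: "real \<Rightarrow> 'a"
  assumes P': "\<And>z. (P has_derivative J z) (at z)"
    and J_bound: "\<And>z u. norm (J z u) \<le> h * norm u"
    and P_lipschitz: "L-lipschitz_on UNIV P"
    and P_monotone: "\<And>z. (z - x0) \<bullet> (P z - P x0) \<ge> m * (norm (z - x0))\<^sup>2"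
    and P_x0: "P x0 = 0"
    and x': "\<And>t. t \<ge> 0 \<Longrightarrow> (x has_vector_derivative v t) (at t within {0..})"
    and v': "\<And>t. t \<ge> 0 \<Longrightarrow>
      (v has_vector_derivative - k1 *\<^sub>R P (x t) - k1 *\<^sub>R y t) (at t within {0..})"
    and y': "\<And>t. t \<ge> 0 \<Longrightarrow> (y has_vector_derivative k2 *\<^sub>R (v t - y t)) (at t within {0..})"
    and "h \<ge> 0" "m > 0" "\<epsilon> > 0"
    and eps_bound: "\<epsilon> > (h * L + 1) / (2 * m)"
    and k1_bound: "k1 > h + \<epsilon> * (h * L + 1) / 2"
    and k2_bound: "k2 > k1"
  shows "(x \<longlongrightarrow> x0) at_top" and "(v \<longlongrightarrow> 0) at_top"
proof -
  define d where "d t = x t - x0" for t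
  define w where "w t = v t + P (x t)" for t
  define e where "e t = y t - v t" for t
  define V where "V t = (norm (d t))\<^sup>2 + (norm (w t))\<^sup>2 + (norm (e t))\<^sup>2" for t
  define V' where "V' t = 2 * (d t \<bullet> v t + w t \<bullet> (J (x t) (v t) - k1 *\<^sub>R w t - k1 *\<^sub>R e t)
      + e t \<bullet> (k1 *\<^sub>R w t - (k2 - k1) *\<^sub>R e t))" for t
  define c where "c = h * L + 1"
  define a where "a = 2 * min (m - c / (2 * \<epsilon>)) (min (k1 - h - \<epsilon> * c / 2) (k2 - k1))"
  have L: "L \<ge> 0" using P_lipschitz by (rule lipschitz_on_nonneg)
  have c: "c > 0" using \<open>h \<ge> 0\<close> L by (simp add: c_def add_nonneg_pos)
  have "m - c / (2 * \<epsilon>) > 0"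
    using eps_bound \<open>m > 0\<close> \<open>\<epsilon> > 0\<close> by (simp add: c_def field_simps)
  have a_le: "a \<le> 2 * (m - c / (2 * \<epsilon>))" "a \<le> 2 * (k1 - h - \<epsilon> * c / 2)" "a \<le> 2 * (k2 - k1)"
    unfolding a_def by (intro mult_left_mono min.cobounded1 min.coboundedI2 min.cobounded2; simp)+
  have a: "a > 0" using \<open>m - c / (2 * \<epsilon>) > 0\<close> k1_bound k2_bound by (simp add: a_def c_def)
  have P_bound: "norm (P (x t)) \<le> L * norm (d t)" for t
    using lipschitz_onD[OF P_lipschitz, of "x t" x0] by (simp add: dist_norm P_x0 d_def)
  have d': "(d has_vector_derivative v t) (at t within {0..})" if "t \<ge> 0" for t
    unfolding d_def using x'[OF that] by (auto intro!: derivative_eq_intros)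
  have w': "(w has_vector_derivative J (x t) (v t) - k1 *\<^sub>R w t - k1 *\<^sub>R e t) (at t within {0..})"
    if "t \<ge> 0" for t
  proof -
    have "(P \<circ> x has_vector_derivative J (x t) (v t)) (at t within {0..})"
      by (rule vector_derivative_diff_chain_within[OF x'[OF that]])
        (rule has_derivative_at_withinI[OF P'])
    from has_vector_derivative_add[OF v'[OF that] this] show ?thesis
      by (simp add: w_def[abs_def] e_def o_def algebra_simps)
  qed
  have e': "(e has_vector_derivative k1 *\<^sub>R w t - (k2 - k1) *\<^sub>R e t) (at t within {0..})"
    if "t \<ge> 0" for t
    using has_vector_derivative_diff[OF y'[OF that] v'[OF that]]
    by (simp add: w_def e_def[abs_def] algebra_simps)
  have norm_square': "((\<lambda>t. (norm (g t))\<^sup>2) has_real_derivative 2 * (g t \<bullet> g')) (at t within S)"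
    if "(g has_vector_derivative g') (at t within S)" for g :: "real \<Rightarrow> 'a" and g' t S
    using has_derivative_inner[OF that[unfolded has_vector_derivative_def]
        that[unfolded has_vector_derivative_def]]
    by (simp add: power2_norm_eq_inner has_field_derivative_def inner_commute
        mult_commute_abs algebra_simps)
  have V': "(V has_real_derivative V' t) (at t within {0..})" if "t \<ge> 0" for t
    unfolding V_def[abs_def] V'_def distrib_left
    by (intro DERIV_add norm_square' d' w' e' that)
  have decay: "V' t \<le> - a * V t" for t
  proof -
    let ?p = "norm (d t)" and ?q = "norm (w t)" and ?r = "norm (e t)"
    have "d t \<bullet> v t = d t \<bullet> w t - d t \<bullet> P (x t)" by (simp add: w_def inner_add_right)
    also have "\<dots> \<le> ?p * ?q - m * ?p\<^sup>2"
      using P_monotone[of "x t"] norm_cauchy_schwarz[of "d t" "w t"] by (simp add: P_x0 d_def)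
    finally have 1: "d t \<bullet> v t \<le> ?p * ?q - m * ?p\<^sup>2" .
    have "norm (v t) \<le> ?q + norm (P (x t))"
      using norm_triangle_ineq4[of "w t" "P (x t)"] by (simp add: w_def)
    then have "norm (v t) \<le> ?q + L * ?p" using P_bound[of t] by linarith
    then have "norm (J (x t) (v t)) \<le> h * (?q + L * ?p)"
      using J_bound[of "x t" "v t"] mult_left_mono[OF _ \<open>h \<ge> 0\<close>] order_trans by blast
    then have "w t \<bullet> J (x t) (v t) \<le> ?q * (h * (?q + L * ?p))"
      using norm_cauchy_schwarz mult_left_mono[OF _ norm_ge_zero] order_trans by blast
    then have 2: "w t \<bullet> J (x t) (v t) \<le> h * ?q\<^sup>2 + h * L * (?p * ?q)"
      by (simp add: power2_eq_square algebra_simps)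
    \<comment> \<open>Young's inequality for \<open>?p * ?q\<close>, with the weight \<open>\<epsilon>\<close> that the gain condition uses.\<close>
    have "0 \<le> (?p / \<epsilon> - ?q)\<^sup>2 * \<epsilon>" using \<open>\<epsilon> > 0\<close> by simp
    also have "\<dots> = ?p\<^sup>2 / \<epsilon> - 2 * (?p * ?q) + \<epsilon> * ?q\<^sup>2"
      using \<open>\<epsilon> > 0\<close> by (simp add: power2_eq_square field_simps)
    finally have "?p * ?q \<le> (?p\<^sup>2 / \<epsilon> + \<epsilon> * ?q\<^sup>2) / 2" by simp
    then have 3: "c * (?p * ?q) \<le> c * ((?p\<^sup>2 / \<epsilon> + \<epsilon> * ?q\<^sup>2) / 2)"
      using c by (intro mult_left_mono) auto
    \<comment> \<open>The terms \<open>- k1 * (w t \<bullet> e t)\<close> and \<open>k1 * (e t \<bullet> w t)\<close> cancel.\<close>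
    have "V' t = 2 * (d t \<bullet> v t + w t \<bullet> J (x t) (v t) - k1 * ?q\<^sup>2 - (k2 - k1) * ?r\<^sup>2)"
      by (simp add: V'_def inner_diff_right inner_commute power2_norm_eq_inner)
    also have "\<dots> \<le> 2 * (c * (?p * ?q) - m * ?p\<^sup>2 + h * ?q\<^sup>2 - k1 * ?q\<^sup>2 - (k2 - k1) * ?r\<^sup>2)"
      using 1 2 by (simp add: c_def algebra_simps)
    also have "\<dots> \<le> 2 * (c * ((?p\<^sup>2 / \<epsilon> + \<epsilon> * ?q\<^sup>2) / 2) - m * ?p\<^sup>2 + h * ?q\<^sup>2 - k1 * ?q\<^sup>2
        - (k2 - k1) * ?r\<^sup>2)"
      using 3 by simp
    also have "\<dots> = - (2 * (m - c / (2 * \<epsilon>)) * ?p\<^sup>2 + 2 * (k1 - h - \<epsilon> * c / 2) * ?q\<^sup>2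
        + 2 * (k2 - k1) * ?r\<^sup>2)"
      by (simp add: algebra_simps add_divide_distrib)
    also have "\<dots> \<le> - (a * ?p\<^sup>2 + a * ?q\<^sup>2 + a * ?r\<^sup>2)"
      unfolding neg_le_iff_le using a_le by (intro add_mono mult_right_mono) auto
    also have "\<dots> = - a * V t" by (simp add: V_def algebra_simps)
    finally show ?thesis .
  qed
  have V_lim: "(V \<longlongrightarrow> 0) at_top"
    by (rule lyapunov_decay[OF V' decay _ a]) (auto simp: V_def)
  have lim: "(g \<longlongrightarrow> 0) at_top" if "\<And>t. (norm (g t))\<^sup>2 \<le> V t" for g :: "real \<Rightarrow> 'a"
  proof -
    have "((\<lambda>t. sqrt (V t)) \<longlongrightarrow> 0) at_top"
      using tendsto_real_sqrt[OF V_lim] by simp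
    moreover have "norm (g t) \<le> sqrt (V t)" for t
      using that by (simp add: real_le_rsqrt)
    ultimately show ?thesis
      by (intro Lim_null_comparison[of g "\<lambda>t. sqrt (V t)"]) auto
  qed
  have d_lim: "(d \<longlongrightarrow> 0) at_top" and w_lim: "(w \<longlongrightarrow> 0) at_top"
    by (auto intro!: lim simp: V_def)
  then show "(x \<longlongrightarrow> x0) at_top"
    unfolding d_def[abs_def] by (auto dest: LIM_zero_cancel)
  \<comment> \<open>The velocity is recovered as \<open>v = w - P x\<close>, and \<open>P x\<close> vanishes with \<open>d\<close>.\<close>
  have "((\<lambda>t. L * norm (d t)) \<longlongrightarrow> 0) at_top"
    using tendsto_mult_right_zero[OF tendsto_norm_zero[OF d_lim]] .
  then have "((\<lambda>t. P (x t)) \<longlongrightarrow> 0) at_top"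
    by (rule Lim_null_comparison[rotated]) (simp add: P_bound)
  from tendsto_diff[OF w_lim this] show "(v \<longlongrightarrow> 0) at_top"
    by (simp add: w_def[abs_def])
qed

section \<open>Nash equilibrium seeking\<close>

theorem theorem2:
  fixes f :: "'n::finite \<Rightarrow> real ^ 'n \<Rightarrow> real"
    and l :: "'n \<Rightarrow> real"
    and m h k1 k2 \<epsilon> :: real
    and xstar :: "real ^ 'n"
    and x v xhat :: "real \<Rightarrow> real ^ 'n"
  assumes C2: "\<And>i. twice_continuously_differentiable (f i)"
    and m_pos: "m > 0"
    and strongly_monotone:
      "\<And>y z. (y - z) \<bullet> (pseudo_gradient f y - pseudo_gradient f z) \<ge> m * (norm (y - z))\<^sup>2"
    and h_pos: "h > 0"
    and hessian_bdd: "bdd_above (range (\<lambda>z. onorm ((*v) (game_hessian f z))))"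
    and hessian_sup: "(SUP z. onorm ((*v) (game_hessian f z))) = h"
    and lipschitz: "\<And>i. (l i)-lipschitz_on UNIV (partial_deriv i (f i))"
    and k1_pos: "k1 > 0"
    and k2_pos: "k2 > 0"
    and eps_pos: "\<epsilon> > 0"
    and eps_bound: "\<epsilon> > (h * sqrt (real CARD('n)) * Max (range l) + 1) / (2 * m)"
    and k1_bound: "k1 > h + \<epsilon> * (h * sqrt (real CARD('n)) * Max (range l) + 1) / 2"
    and k2_bound: "k2 > k1"
    and nash: "nash_equilibrium f xstar"
    and solution: "closed_loop_solution f k1 k2 x v xhat"
  shows "((\<lambda>t. norm (x t - xstar)) \<longlongrightarrow> 0) at_top \<and> ((\<lambda>t. norm (v t)) \<longlongrightarrow> 0) at_top"
proof -
  let ?P = "pseudo_gradient f" and ?L = "sqrt (real CARD('n)) * Max (range l)"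
  define y where "y t = filter_estimate k2 (x t) (xhat t)" for t
  have P': "(?P has_derivative (*v) (game_hessian f z)) (at z)" for z
    using C2 by (rule has_derivative_pseudo_gradient)
  have "onorm ((*v) (game_hessian f z)) \<le> h" for z
    using cSUP_upper[OF UNIV_I hessian_bdd] hessian_sup by simp
  then have H_bound: "norm (game_hessian f z *v u) \<le> h * norm u" for z u
    using onorm[OF matrix_vector_mul_bounded_linear] mult_right_mono[OF _ norm_ge_zero] order_trans
    by blast
  have P_lipschitz: "?L-lipschitz_on UNIV ?P"
    using lipschitz_on_vec_lambda[OF lipschitz] by (simp add: pseudo_gradient_def[abs_def])
  have "f i differentiable (at xstar)" for i
    using C2[of i] by (auto simp: twice_continuously_differentiable_def differentiable_def)
  then have P_zero: "?P xstar = 0"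
    using nash by (rule nash_equilibrium_pseudo_gradient_zero)
  have x': "(x has_vector_derivative v t) (at t within {0..})"
    and v': "(v has_vector_derivative - k1 *\<^sub>R ?P (x t) - k1 *\<^sub>R y t) (at t within {0..})"
    and xhat': "(xhat has_vector_derivative - k2 *\<^sub>R xhat t + k2\<^sup>2 *\<^sub>R x t) (at t within {0..})"
    if "t \<ge> 0" for t
    using solution that by (auto simp: closed_loop_solution_def filter_control_def y_def)
  have y': "(y has_vector_derivative k2 *\<^sub>R (v t - y t)) (at t within {0..})" if "t \<ge> 0" for t
  proof -
    have "((\<lambda>t. - xhat t + k2 *\<^sub>R x t) has_vector_derivative
        - (- k2 *\<^sub>R xhat t + k2\<^sup>2 *\<^sub>R x t) + k2 *\<^sub>R v t) (at t within {0..})"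
      by (intro has_vector_derivative_add has_vector_derivative_minus xhat' that
          bounded_linear.has_vector_derivative[OF bounded_linear_scaleR_right] x')
    then show ?thesis
      by (simp add: y_def[abs_def] filter_estimate_def algebra_simps power2_eq_square)
  qed
  have "h \<ge> 0" using h_pos by simp
  note convergence = filtered_double_integrator_converges[OF P' H_bound P_lipschitz
      strongly_monotone P_zero x' v' y' \<open>h \<ge> 0\<close> m_pos eps_pos _ _ k2_bound]
  have "(x \<longlongrightarrow> xstar) at_top" "(v \<longlongrightarrow> 0) at_top"
    using eps_bound k1_bound by (auto intro!: convergence simp: mult.assoc)
  then show ?thesis
    by (auto intro!: tendsto_norm_zero simp: Lim_null[of x xstar])
qed

end
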